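(* Let $G$ be a finite simple graph on $n$ vertices with chromatic number $\chi(G)=n-3$. Then the $\sigma$-polynomial $\sigma(G,x)$ has only real roots.
   Context: For a graph $G$ of order $n$ with chromatic number $\chi(G)$, the $\sigma$-polynomial of $G$ is $\sigma(G,x)=\sum_{i=\chi(G)}^{n} a_i x^i$, where $a_i$ is the number of partitions of the vertex set of $G$ into $i$ nonempty independent sets. *)

theory Defs
  imports
    Complex_Main
    "HOL-Library.Disjoint_Sets"
    "HOL-Computational_Algebra.Polynomial"
    "Graph_Theory.Pair_Digraph"
begin

text \<open>A finite simple graph is a \<^locale>\<open>pair_graph\<close>: a finite vertex set
  with a symmetric, loop-free set of arcs. An edge is the pair of its two opposite arcs.\<close>

definition independent_set :: "'a pair_pre_digraph \<Rightarrow> 'a set \<Rightarrow> bool" where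
  "independent_set G S \<longleftrightarrow> S \<subseteq> pverts G \<and> (\<forall>u\<in>S. \<forall>v\<in>S. (u, v) \<notin> parcs G)"

definition proper_colouring :: "'a pair_pre_digraph \<Rightarrow> nat \<Rightarrow> ('a \<Rightarrow> nat) \<Rightarrow> bool" where
  "proper_colouring G k f \<longleftrightarrow>
     f ` pverts G \<subseteq> {..<k} \<and> (\<forall>(u, v) \<in> parcs G. f u \<noteq> f v)"

definition chromatic_number :: "'a pair_pre_digraph \<Rightarrow> nat" where
  "chromatic_number G = (LEAST k. \<exists>f. proper_colouring G k f)"

definition independent_partitions :: "'a pair_pre_digraph \<Rightarrow> nat \<Rightarrow> 'a set set set" where
  "independent_partitions G i =
     {P. partition_on (pverts G) P \<and> card P = i \<and> (\<forall>S\<in>P. independent_set G S)}"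

definition sigma_poly :: "'a pair_pre_digraph \<Rightarrow> int poly" where
  "sigma_poly G =
     (\<Sum>i = chromatic_number G..card (pverts G). monom (int (card (independent_partitions G i))) i)"

end

theory Submission
  imports
    Defs
    "HOL-Computational_Algebra.Fundamental_Theorem_Algebra"
    "HOL-Library.Nonpos_Ints"
begin

text \<open>In the complementary graph \<open>H\<close>, the \<open>\<sigma>\<close>-polynomial counts partitions of the vertices into
  cliques, and the hypothesis says that every clique partition of \<open>H\<close> has at least \<open>n - 3\<close> blocks.
  If \<open>H\<close> is triangle-free, clique partitions are matchings and the theorem of Heilmann and Lieb
  applies. If \<open>H\<close> contains a triangle \<open>T\<close>, then \<open>H - T\<close> has neither two disjoint edges nor a
  triangle, so that it is a star and \<open>H\<close> consists of \<open>T\<close>, a vertex \<open>v\<close> and a coclique \<open>I\<close>.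
  Adding to \<open>W \<union> I\<close> a vertex adjacent to all of \<open>W\<close> replaces the polynomial \<open>p\<close> by
  \<open>(x + c) p + x p'\<close>, which keeps the zeros real. This disposes of the vertices of \<open>T\<close> adjacent
  to \<open>v\<close>; what remains is, up to a power of \<open>x\<close>, of degree at most three and has only real
  zeros by its sign changes, except if \<open>v\<close> has no neighbour in \<open>T\<close>. In that case the bound on
  the number of blocks forces every neighbour of \<open>v\<close> in \<open>I\<close> to be the only possible neighbour in
  \<open>I\<close> of some vertex of \<open>T\<close>, which leaves two explicit families.\<close>

section \<open>Polynomials with real zeros\<close>

text \<open>A nonreal zero s + it forces the factorization (x + c + 2s)((x - s)^2 + t^2), whose
  second factor is positive. The cubic then has the sign of an increasing linear function and cannot
  go from \<ge> 0 at \<open>u\<close> to \<le> 0 at \<open>w\<close>.\<close>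

lemma real_cubic_root_real:
  fixes z :: complex and a b c u w :: real
  assumes root: "z ^ 3 + of_real c * z ^ 2 + of_real b * z + of_real a = 0"
    and "u < w" and u: "u ^ 3 + c * u ^ 2 + b * u + a \<ge> 0"
    and w: "w ^ 3 + c * w ^ 2 + b * w + a \<le> 0"
  shows "z \<in> \<real>"
proof (rule ccontr)
  assume "z \<notin> \<real>"
  define s t where "s = Re z" and "t = Im z"
  have z: "z = Complex s t"
    by (simp add: s_def t_def)
  have t: "t \<noteq> 0"
    using \<open>z \<notin> \<real>\<close> by (simp add: t_def complex_is_Real_iff)
  have im: "t * (3 * s^2 - t^2 + 2 * c * s + b) = 0"
    using arg_cong[OF root, of Im]
    by (simp add: z power2_eq_square power3_eq_cube algebra_simps)
  have b: "b = t^2 - 3 * s^2 - 2 * c * s"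
    using im t by simp
  have re: "s^3 - 3 * s * t^2 + c * (s^2 - t^2) + b * s + a = 0"
    using arg_cong[OF root, of Re]
    by (simp add: z power2_eq_square power3_eq_cube algebra_simps)
  have fact: "x ^ 3 + c * x ^ 2 + b * x + a = (x + c + 2 * s) * ((x - s)^2 + t^2)" for x
    using re unfolding b by algebra
  have pos: "(x - s)^2 + t^2 > 0" for x
    using t by (simp add: add_nonneg_pos)
  have "u + c + 2 * s \<ge> 0" "w + c + 2 * s \<le> 0"
    using u w pos[of u] pos[of w] unfolding fact
    by (simp_all add: zero_le_mult_iff mult_le_0_iff)
  then show False
    using \<open>u < w\<close> by simp
qed

text \<open>The shape produced by \<open>cpoly_add_vertex\<close>: a quadratic times z, plus one
  quadratic for each neighbour of the new vertex. The signs can then be checked summand by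
  summand.\<close>

lemma real_cubic_sum_root_real:
  fixes z :: complex and A B u w :: real and f g :: "'b \<Rightarrow> real"
  assumes root: "z * (z^2 + of_real A * z + of_real B)
      + (\<Sum>l\<in>L. z^2 + of_real (f l) * z + of_real (g l)) = 0"
    and "u < w"
    and u: "u * (u^2 + A * u + B) + (\<Sum>l\<in>L. u^2 + f l * u + g l) \<ge> 0"
    and w: "w * (w^2 + A * w + B) + (\<Sum>l\<in>L. w^2 + f l * w + g l) \<le> 0"
  shows "z \<in> \<real>"
proof (rule real_cubic_root_real)
  let ?c = "A + real (card L)" and ?b = "B + sum f L" and ?a = "sum g L"
  have expand: "t ^ 3 + ?c * t ^ 2 + ?b * t + ?a
      = t * (t^2 + A * t + B) + (\<Sum>l\<in>L. t^2 + f l * t + g l)" for t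
    by (simp add: sum.distrib sum_distrib_left sum_distrib_right power2_eq_square power3_eq_cube algebra_simps)
  show "u ^ 3 + ?c * u ^ 2 + ?b * u + ?a \<ge> 0" "w ^ 3 + ?c * w ^ 2 + ?b * w + ?a \<le> 0"
    using u w unfolding expand .
  have "z ^ 3 + of_real ?c * z ^ 2 + of_real ?b * z + of_real ?a
      = z * (z^2 + of_real A * z + of_real B) + (\<Sum>l\<in>L. z^2 + of_real (f l) * z + of_real (g l))"
    by (simp add: sum.distrib sum_distrib_left sum_distrib_right power2_eq_square power3_eq_cube algebra_simps)
  then show "z ^ 3 + of_real ?c * z ^ 2 + of_real ?b * z + of_real ?a = 0"
    using root by simp
qed fact

lemma real_quadratic_root_real:
  fixes z :: complex and b c u :: real
  assumes root: "z ^ 2 + of_real b * z + of_real c = 0"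
    and u: "u ^ 2 + b * u + c \<le> 0"
  shows "z \<in> \<real>"
proof (rule ccontr)
  assume "z \<notin> \<real>"
  define s t where "s = Re z" and "t = Im z"
  have z: "z = Complex s t"
    by (simp add: s_def t_def)
  have t: "t \<noteq> 0"
    using \<open>z \<notin> \<real>\<close> by (simp add: t_def complex_is_Real_iff)
  have "t * (2 * s + b) = 0"
    using arg_cong[OF root, of Im] by (simp add: z power2_eq_square algebra_simps)
  then have b: "b = - 2 * s"
    using t by simp
  have "s^2 - t^2 + b * s + c = 0"
    using arg_cong[OF root, of Re] by (simp add: z power2_eq_square algebra_simps)
  then have "u ^ 2 + b * u + c = (u - s)^2 + t^2"
    unfolding b by algebra
  then show False
    using u t by (smt (verit) zero_less_power2 zero_le_power2)
qed

text \<open>The logarithmic derivative of a polynomial with nonpositive zeros satisfies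
  \<open>z p'(z) / p(z) = \<Sum> z / (z + \<rho>)\<close> with \<open>\<rho> \<ge> 0\<close>, and every summand has an imaginary part
  of the same sign as that of \<open>z\<close>.\<close>

lemma nonpos_roots_shift_pderiv:
  fixes p :: "complex poly" and z :: complex and c :: real
  assumes "p \<noteq> 0"
    and nonpos: "\<And>z. poly p z = 0 \<Longrightarrow> z \<in> \<real>\<^sub>\<le>\<^sub>0"
    and root: "(z + of_real c) * poly p z + z * poly (pderiv p) z = 0"
  shows "z \<in> \<real>"
proof (rule ccontr)
  assume z: "z \<notin> \<real>"
  obtain A where A: "p = smult (lead_coeff p) (\<Prod>x\<in>#A. [:-x, 1:])"
    using alg_closed_imp_factorization[OF \<open>p \<noteq> 0\<close>] by blast
  have log: "\<exists>s\<ge>0. Im (z * poly (pderiv q) z / poly q z) = s * Im z \<and> poly q z \<noteq> 0"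
    if "q = (\<Prod>x\<in>#B. [:-x, 1:])" "\<And>x. x \<in># B \<Longrightarrow> x \<in> \<real>\<^sub>\<le>\<^sub>0" for q and B :: "complex multiset"
    using that
  proof (induction B arbitrary: q)
    case empty
    then show ?case by (auto intro!: exI[of _ 0])
  next
    case (add x B)
    define r where "r = (\<Prod>x\<in>#B. [:-x, 1:])"
    obtain s where s: "s \<ge> 0" "Im (z * poly (pderiv r) z / poly r z) = s * Im z" "poly r z \<noteq> 0"
      using add r_def by auto
    obtain \<rho> where \<rho>: "x = of_real \<rho>" "\<rho> \<le> 0"
      using add.prems(2)[of x] by (auto elim: nonpos_Reals_cases)
    have q: "q = [:-x, 1:] * r"
      using add.prems(1) by (simp add: r_def)
    have zx: "z - x \<noteq> 0"
      using z \<rho>(1) by auto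
    have "z * poly (pderiv q) z / poly q z = z / (z - x) + z * poly (pderiv r) z / poly r z"
      using zx s(3) unfolding q pderiv_mult by (simp add: pderiv_pCons field_simps)
    moreover have "Im (z / (z - x)) = (- \<rho> / (cmod (z - x))^2) * Im z"
      using zx unfolding \<rho>(1) by (simp add: Im_divide cmod_power2 algebra_simps divide_simps)
    ultimately have "Im (z * poly (pderiv q) z / poly q z) = (- \<rho> / (cmod (z - x))^2 + s) * Im z"
      using s(2) by (simp add: algebra_simps)
    moreover have "- \<rho> / (cmod (z - x))^2 + s \<ge> 0"
      using \<rho>(2) s(1) by (intro add_nonneg_nonneg divide_nonneg_nonneg) simp_all
    moreover have "poly q z \<noteq> 0"
      using zx s(3) by (simp add: q)
    ultimately show ?case by blast
  qed
  define q where "q = (\<Prod>x\<in>#A. [:-x, 1:])"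
  have "x \<in> \<real>\<^sub>\<le>\<^sub>0" if "x \<in># A" for x
  proof (rule nonpos)
    show "poly p x = 0"
      using that by (subst A) (auto simp: poly_prod_mset prod_mset_zero_iff)
  qed
  then obtain s where s: "s \<ge> 0" "Im (z * poly (pderiv q) z / poly q z) = s * Im z" "poly q z \<noteq> 0"
    using log[OF q_def] by blast
  have p: "p = smult (lead_coeff p) q"
    using A by (simp add: q_def)
  have "lead_coeff p * ((z + of_real c) * poly q z + z * poly (pderiv q) z) = 0"
    using root by (subst (asm) (1 2) p) (simp add: pderiv_smult algebra_simps)
  then have "(z + of_real c) * poly q z + z * poly (pderiv q) z = 0"
    using \<open>p \<noteq> 0\<close> by simp
  then have "z + of_real c + z * poly (pderiv q) z / poly q z = 0"
    using s(3) by (simp add: field_simps)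
  then have "Im (z + of_real c + z * poly (pderiv q) z / poly q z) = 0"
    by simp
  \<comment> \<open>As \<open>c\<close> is real, z + c has imaginary part Im z; and 1 + s >
    0.\<close>
  then have "Im z * (1 + s) = 0"
    using s(2) by (simp only: plus_complex.sel Im_complex_of_real) (simp add: algebra_simps)
  then show False
    using z s(1) by (auto simp: complex_is_Real_iff)
qed

section \<open>Clique partitions\<close>

locale adjacency =
  fixes adj :: "'a \<Rightarrow> 'a \<Rightarrow> bool"
  assumes adj_sym: "adj u v \<Longrightarrow> adj v u"
    and adj_irrefl: "\<not> adj u u"
begin

definition clique :: "'a set \<Rightarrow> bool" where
  "clique S \<longleftrightarrow> (\<forall>u\<in>S. \<forall>v\<in>S. u \<noteq> v \<longrightarrow> adj u v)"

definition coclique :: "'a set \<Rightarrow> bool" where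
  "coclique S \<longleftrightarrow> (\<forall>u\<in>S. \<forall>v\<in>S. \<not> adj u v)"

definition nbrs :: "'a \<Rightarrow> 'a set \<Rightarrow> 'a set" where
  "nbrs v A = {u \<in> A. adj v u}"

definition clique_partitions :: "'a set \<Rightarrow> 'a set set set" where
  "clique_partitions V = {P. partition_on V P \<and> (\<forall>S\<in>P. clique S)}"

text \<open>For the complement of a graph this is its \<sigma>-polynomial with complex coefficients.
  Indexing by partitions instead of block numbers lets recurrences split the sum by blocks.\<close>

definition cpoly :: "'a set \<Rightarrow> complex poly" where
  "cpoly V = (\<Sum>P\<in>clique_partitions V. monom 1 (card P))"

definition real_rooted :: "'a set \<Rightarrow> bool" where
  "real_rooted V \<longleftrightarrow> (\<forall>x. poly (cpoly V) x = 0 \<longrightarrow> x \<in> \<real>)"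

lemma poly_cpoly: "poly (cpoly V) x = (\<Sum>P\<in>clique_partitions V. x ^ card P)"
  by (simp add: cpoly_def poly_sum poly_monom)

text \<open>The operator x d/dx weights a partition by its number of blocks, that is, by the choices
  of a block to be enlarged. The factor x keeps the exponent at \<open>card P\<close>.\<close>

lemma poly_pderiv_cpoly:
  "x * poly (pderiv (cpoly V)) x = (\<Sum>P\<in>clique_partitions V. of_nat (card P) * x ^ card P)"
proof -
  have "x * poly (pderiv (monom 1 n)) x = of_nat n * x ^ n" for n
    by (cases n) (simp_all add: pderiv_monom poly_monom monom_0)
  moreover have "pderiv (cpoly V) = (\<Sum>P\<in>clique_partitions V. pderiv (monom 1 (card P)))"
    unfolding cpoly_def by (rule higher_pderiv_sum[where n = 1, simplified])
  ultimately show ?thesis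
    by (simp add: poly_sum sum_distrib_left)
qed

lemma finite_nbrs: "finite A \<Longrightarrow> finite (nbrs v A)"
  by (simp add: nbrs_def)

lemma finite_clique_partitions: "finite V \<Longrightarrow> finite (clique_partitions V)"
  by (simp add: clique_partitions_def finitely_many_partition_on)

lemma finite_clique_partition: "finite V \<Longrightarrow> P \<in> clique_partitions V \<Longrightarrow> finite P"
  by (auto simp: clique_partitions_def intro: finite_elements)

lemma clique_Int_coclique:
  assumes "coclique I" "u \<in> I" "clique S" "u \<in> S"
  shows "S \<inter> I = {u}"
  using assms by (auto simp: coclique_def clique_def)

section \<open>Recurrences from the block of a vertex\<close>

text \<open>Deleting the block \<open>D\<close> is a bijection onto the clique partitions of
  \<open>V - D\<close> and costs one factor x. Being nonempty, \<open>D\<close> is never a block of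
  the smaller partition.\<close>

lemma sum_partitions_with_block:
  assumes fin: "finite V" and D: "clique D" "D \<noteq> {}" "D \<subseteq> V"
  shows "(\<Sum>P\<in>{P \<in> clique_partitions V. D \<in> P}. x ^ card P) = x * poly (cpoly (V - D)) x"
proof -
  have notin: "D \<notin> P" if "P \<in> clique_partitions (V - D)" for P
    using that D(2) by (auto simp: clique_partitions_def partition_on_def)
  have bij: "bij_betw (insert D) (clique_partitions (V - D)) {P \<in> clique_partitions V. D \<in> P}"
  proof (rule bij_betw_byWitness[where f' = "\<lambda>P. P - {D}"])
    show "\<forall>P\<in>clique_partitions (V - D). insert D P - {D} = P"
      using notin by auto
    show "\<forall>P\<in>{P \<in> clique_partitions V. D \<in> P}. insert D (P - {D}) = P"
      by auto
    show "insert D ` clique_partitions (V - D) \<subseteq> {P \<in> clique_partitions V. D \<in> P}"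
    proof
      fix Q assume "Q \<in> insert D ` clique_partitions (V - D)"
      then obtain P where Q: "Q = insert D P" and P: "P \<in> clique_partitions (V - D)"
        by auto
      have "partition_on V Q"
      proof -
        have part: "partition_on (V - D) P"
          using P by (simp add: clique_partitions_def)
        have U: "\<Union>P = V - D"
          using partition_onD1[OF part] by simp
        have "B \<inter> D = {}" if "B \<in> P" for B
          using that U by blast
        then have "disjoint Q"
          using partition_onD2[OF part] by (auto simp: Q disjoint_def)
        moreover have "\<Union>Q = V"
          using U D(3) by (auto simp: Q)
        moreover have "{} \<notin> Q"
          using partition_onD3[OF part] D(2) by (simp add: Q)
        ultimately show ?thesis
          by (simp add: partition_on_def)
      qed
      then show "Q \<in> {P \<in> clique_partitions V. D \<in> P}"
        using P D(1) by (auto simp: Q clique_partitions_def)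
    qed
    show "(\<lambda>P. P - {D}) ` {P \<in> clique_partitions V. D \<in> P} \<subseteq> clique_partitions (V - D)"
    proof
      fix Q assume "Q \<in> (\<lambda>P. P - {D}) ` {P \<in> clique_partitions V. D \<in> P}"
      then obtain P where Q: "Q = P - {D}" and P: "P \<in> clique_partitions V" "D \<in> P"
        by auto
      have part: "partition_on V P"
        using P by (simp add: clique_partitions_def)
      have "\<Union>Q = V - D"
        using partition_onD1[OF part] partition_onD2[OF part] P(2)
        unfolding Q disjoint_def by blast
      moreover have "disjoint Q"
        using partition_onD2[OF part] by (auto simp: Q disjoint_def)
      moreover have "{} \<notin> Q"
        using partition_onD3[OF part] by (simp add: Q)
      ultimately show "Q \<in> clique_partitions (V - D)"
        using P by (auto simp: Q clique_partitions_def partition_on_def)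
    qed
  qed
  have "(\<Sum>P\<in>{P \<in> clique_partitions V. D \<in> P}. x ^ card P)
      = (\<Sum>P\<in>clique_partitions (V - D). x ^ card (insert D P))"
    by (rule sum.reindex_bij_betw[OF bij, symmetric])
  also have "\<dots> = (\<Sum>P\<in>clique_partitions (V - D). x * x ^ card P)"
    using notin finite_clique_partition[of "V - D"] fin by (intro sum.cong) simp_all
  finally show ?thesis
    by (simp add: poly_cpoly sum_distrib_left)
qed

text \<open>Every partition has exactly one block containing \<open>v\<close>, and the partitions
  are sorted by it.\<close>

lemma poly_cpoly_block_expansion:
  assumes fin: "finite V" and v: "v \<in> V"
  shows "poly (cpoly V) x = (\<Sum>C | C \<subseteq> V \<and> v \<in> C \<and> clique C. x * poly (cpoly (V - C)) x)"
proof -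
  have one: "(\<Sum>C | C \<subseteq> V \<and> v \<in> C \<and> clique C. if C \<in> P then x ^ card P else 0) = x ^ card P"
    if P: "P \<in> clique_partitions V" for P
  proof -
    obtain B where B: "B \<in> P" "v \<in> B"
      using P v by (auto simp: clique_partitions_def partition_on_def)
    have uniq: "C = B" if "C \<in> P" "v \<in> C" for C
    proof -
      have "disjoint P"
        using P by (simp add: clique_partitions_def partition_on_def)
      then show ?thesis
        using that B unfolding disjoint_def by blast
    qed
    have BV: "B \<subseteq> V" "clique B"
      using B(1) P by (auto simp: clique_partitions_def partition_on_def)
    have "(\<Sum>C | C \<subseteq> V \<and> v \<in> C \<and> clique C. if C \<in> P then x ^ card P else 0)
        = (\<Sum>C | C \<subseteq> V \<and> v \<in> C \<and> clique C. if C = B then x ^ card P else 0)"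
      using uniq B(1) by (intro sum.cong) auto
    also have "\<dots> = x ^ card P"
      using B BV fin by (subst sum.delta) auto
    finally show ?thesis .
  qed
  have "poly (cpoly V) x = (\<Sum>P\<in>clique_partitions V.
      \<Sum>C | C \<subseteq> V \<and> v \<in> C \<and> clique C. if C \<in> P then x ^ card P else 0)"
    by (simp add: poly_cpoly one)
  also have "\<dots> = (\<Sum>C | C \<subseteq> V \<and> v \<in> C \<and> clique C.
      \<Sum>P\<in>clique_partitions V. if C \<in> P then x ^ card P else 0)"
    by (rule sum.swap)
  also have "\<dots> = (\<Sum>C | C \<subseteq> V \<and> v \<in> C \<and> clique C. x * poly (cpoly (V - C)) x)"
  proof (rule sum.cong)
    fix C assume C: "C \<in> {C. C \<subseteq> V \<and> v \<in> C \<and> clique C}"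
    have "(\<Sum>P\<in>clique_partitions V. if C \<in> P then x ^ card P else 0)
        = (\<Sum>P\<in>{P \<in> clique_partitions V. C \<in> P}. x ^ card P)"
      by (simp add: sum.inter_filter finite_clique_partitions fin)
    then show "(\<Sum>P\<in>clique_partitions V. if C \<in> P then x ^ card P else 0)
        = x * poly (cpoly (V - C)) x"
      using C fin sum_partitions_with_block[of V C x] by auto
  qed simp
  finally show ?thesis .
qed

text \<open>If no two neighbours of \<open>v\<close> are adjacent, the only cliques through
  \<open>v\<close> are {v} and the edges at \<open>v\<close>, which gives the recurrence of the
  matching polynomial.\<close>

lemma cpoly_coclique_nbrs:
  assumes fin: "finite V" and v: "v \<notin> V" and co: "coclique (nbrs v V)"
  shows "poly (cpoly (insert v V)) x =
    x * poly (cpoly V) x + (\<Sum>u\<in>nbrs v V. x * poly (cpoly (V - {u})) x)"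
proof -
  have cliques: "{C. C \<subseteq> insert v V \<and> v \<in> C \<and> clique C} = insert {v} ((\<lambda>u. {v, u}) ` nbrs v V)"
    (is "?A = ?B")
  proof
    show "?A \<subseteq> ?B"
    proof
      fix C assume C: "C \<in> ?A"
      have N: "C - {v} \<subseteq> nbrs v V"
        using C v by (auto simp: clique_def nbrs_def)
      show "C \<in> ?B"
      proof (cases "C = {v}")
        case False
        then obtain u where u: "u \<in> C" "u \<noteq> v"
          using C by auto
        have "w = u" if "w \<in> C" "w \<noteq> v" for w
        proof (rule ccontr)
          assume "w \<noteq> u"
          then have "adj w u"
            using that u C by (simp add: clique_def)
          moreover have "w \<in> nbrs v V" "u \<in> nbrs v V"
            using that u N by blast+
          ultimately show False
            using co by (simp add: coclique_def)
        qed
        then have "C = {v, u}"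
          using C u by blast
        moreover have "u \<in> nbrs v V"
          using N u by blast
        ultimately show ?thesis
          by simp
      qed auto
    qed
    show "?B \<subseteq> ?A"
      using adj_sym by (auto simp: clique_def nbrs_def)
  qed
  have inj: "inj_on (\<lambda>u. {v, u}) (nbrs v V)"
    using v by (auto simp: inj_on_def nbrs_def doubleton_eq_iff)
  have "poly (cpoly (insert v V)) x = (\<Sum>C\<in>?B. x * poly (cpoly (insert v V - C)) x)"
    using poly_cpoly_block_expansion[of "insert v V" v x] fin unfolding cliques by simp
  moreover have "{v} \<notin> (\<lambda>u. {v, u}) ` nbrs v V"
    using v by (auto simp: nbrs_def)
  moreover have "insert v V - {v} = V" "insert v V - {v, u} = V - {u}" for u
    using v by auto
  ultimately show ?thesis
    by (simp add: finite_nbrs fin sum.reindex[OF inj])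
qed

section \<open>Adding a vertex adjacent to everything outside a coclique\<close>

text \<open>A block refuses \<open>c\<close> exactly if it meets \<open>J\<close>, the set of
  non-neighbours of \<open>c\<close> in \<open>I\<close>; being a clique, it meets \<open>J\<close>
  at most once. So the refusing blocks are as many as the elements of \<open>J\<close>. The additive
  form avoids truncated subtraction.\<close>

lemma card_joinable_blocks:
  assumes fin: "finite V" and c: "c \<notin> V" and I: "I \<subseteq> V" "coclique I"
    and full: "\<And>u. u \<in> V - I \<Longrightarrow> adj c u"
    and P: "P \<in> clique_partitions V"
  shows "card {B \<in> P. clique (insert c B)} + card I = card P + card (nbrs c I)"
proof -
  have part: "partition_on V P" and finP: "finite P"
    using P fin by (auto simp: clique_partitions_def intro: finite_elements)
  define J where "J = I - nbrs c I"
  have finI: "finite I"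
    using I fin finite_subset by blast
  have ind: "card (B \<inter> J) = (if clique (insert c B) then 0 else 1)" if B: "B \<in> P" for B
  proof -
    have "B \<subseteq> V" "clique B"
      using B P part by (auto simp: clique_partitions_def partition_on_def)
    show ?thesis
    proof (cases "B \<inter> J = {}")
      case True
      have "adj c u" if "u \<in> B" for u
        using that True full[of u] \<open>B \<subseteq> V\<close> by (auto simp: J_def nbrs_def)
      then have "clique (insert c B)"
        using \<open>clique B\<close> adj_sym by (auto simp: clique_def)
      then show ?thesis
        using True by simp
    next
      case False
      then obtain u where u: "u \<in> B" "u \<in> I" "\<not> adj c u"
        by (auto simp: J_def nbrs_def)
      then have "B \<inter> J = {u}"
        using clique_Int_coclique[OF I(2) u(2) \<open>clique B\<close> u(1)]
        by (auto simp: J_def nbrs_def)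
      moreover have "\<not> clique (insert c B)"
        using u c \<open>B \<subseteq> V\<close> by (auto simp: clique_def)
      ultimately show ?thesis
        by simp
    qed
  qed
  have "J = (\<Union>B\<in>P. B \<inter> J)"
    using partition_onD1[OF part] I by (auto simp: J_def)
  then have "card J = (\<Sum>B\<in>P. card (B \<inter> J))"
    using partition_onD2[OF part] finP finI
    by (subst card_UN_disjoint[symmetric]) (auto simp: J_def disjoint_def)
  also have "\<dots> = (\<Sum>B\<in>P. if \<not> clique (insert c B) then 1 else 0)"
    by (intro sum.cong) (simp_all add: ind)
  also have "\<dots> = card {B \<in> P. \<not> clique (insert c B)}"
    using finP by (simp add: sum.inter_filter[symmetric])
  finally have "card J = card {B \<in> P. \<not> clique (insert c B)}" .
  moreover have "card {B \<in> P. clique (insert c B)} + card {B \<in> P. \<not> clique (insert c B)} = card P"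
    using finP by (subst card_Un_disjoint[symmetric]) (auto intro: arg_cong[where f = card])
  moreover have "card J + card (nbrs c I) = card I"
    unfolding J_def using finI by (subst card_Diff_subset) (auto simp: nbrs_def card_mono)
  ultimately show ?thesis
    by simp
qed

text \<open>In the complementary graph \<open>c\<close> is a simplicial vertex: it can be put into a block of a
  partition of \<open>V\<close> unless that block contains one of the elements of \<open>I\<close> not adjacent to \<open>c\<close>,
  and each of these occupies a block of its own.\<close>

lemma cpoly_insert_simplicial:
  assumes fin: "finite V" and c: "c \<notin> V" and I: "I \<subseteq> V" "coclique I"
    and full: "\<And>u. u \<in> V - I \<Longrightarrow> adj c u"
  shows "poly (cpoly (insert c V)) x =
    (x + of_real (real (card (nbrs c I)) - real (card I))) * poly (cpoly V) x
      + x * poly (pderiv (cpoly V)) x"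
proof -
  \<comment> \<open>\<open>\<D>\<close> collects what can remain of the block of \<open>c\<close>
    once \<open>c\<close> is removed. The block {c} is kept apart, since its remainder {} is not a
    block.\<close>
  define \<D> where "\<D> = {D. D \<subseteq> V \<and> D \<noteq> {} \<and> clique (insert c D)}"
  have fin\<D>: "finite \<D>"
    unfolding \<D>_def using fin by simp
  have cliques: "{C. C \<subseteq> insert c V \<and> c \<in> C \<and> clique C} = insert {c} (insert c ` \<D>)"
    (is "?A = ?B")
  proof
    show "?A \<subseteq> ?B"
    proof
      fix C assume C: "C \<in> ?A"
      show "C \<in> ?B"
      proof (cases "C = {c}")
        case False
        then have "C - {c} \<in> \<D>" "C = insert c (C - {c})"
          using C by (auto simp: \<D>_def insert_absorb)
        then show ?thesis
          by blast
      qed auto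
    qed
    show "?B \<subseteq> ?A"
      by (auto simp: \<D>_def clique_def)
  qed
  have inj: "inj_on (insert c) \<D>"
    using c by (auto simp: inj_on_def \<D>_def)
  have "poly (cpoly (insert c V)) x = (\<Sum>C\<in>?B. x * poly (cpoly (insert c V - C)) x)"
    using poly_cpoly_block_expansion[of "insert c V" c x] fin unfolding cliques by simp
  also have "\<dots> = x * poly (cpoly V) x + (\<Sum>D\<in>\<D>. x * poly (cpoly (V - D)) x)"
  proof -
    have "{c} \<notin> insert c ` \<D>"
      using c by (auto simp: \<D>_def)
    moreover have "insert c V - {c} = V" "insert c V - insert c D = V - D" for D
      using c by auto
    ultimately show ?thesis
      by (simp add: fin\<D> sum.reindex[OF inj])
  qed
  also have "(\<Sum>D\<in>\<D>. x * poly (cpoly (V - D)) x)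
      = (\<Sum>D\<in>\<D>. \<Sum>P\<in>clique_partitions V. if D \<in> P then x ^ card P else 0)"
  proof (rule sum.cong)
    fix D assume D: "D \<in> \<D>"
    have "clique D"
      using D by (auto simp: \<D>_def clique_def)
    then show "x * poly (cpoly (V - D)) x
        = (\<Sum>P\<in>clique_partitions V. if D \<in> P then x ^ card P else 0)"
      using D fin sum_partitions_with_block[of V D x]
      by (simp add: \<D>_def sum.inter_filter finite_clique_partitions)
  qed simp
  also have "\<dots> = (\<Sum>P\<in>clique_partitions V. \<Sum>D\<in>\<D>. if D \<in> P then x ^ card P else 0)"
    by (rule sum.swap)
  also have "\<dots> = (\<Sum>P\<in>clique_partitions V.
      of_real (real (card P) + (real (card (nbrs c I)) - real (card I))) * x ^ card P)"
  proof (rule sum.cong)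
    fix P assume P: "P \<in> clique_partitions V"
    \<comment> \<open>For a fixed partition only the number of joinable blocks matters. It is
      \<open>card P\<close> plus a constant, and the two terms yield the derivative and the multiple
      of the polynomial.\<close>
    have "{D \<in> \<D>. D \<in> P} = {B \<in> P. clique (insert c B)}"
      using P by (auto simp: \<D>_def clique_partitions_def partition_on_def)
    moreover have "real (card {B \<in> P. clique (insert c B)})
        = real (card P) + (real (card (nbrs c I)) - real (card I))"
      using card_joinable_blocks[OF assms P] by linarith
    moreover have "(\<Sum>D\<in>\<D>. if D \<in> P then x ^ card P else 0)
        = of_real (real (card {D \<in> \<D>. D \<in> P})) * x ^ card P"
      using fin\<D> by (simp add: sum.inter_filter[symmetric])
    ultimately show "(\<Sum>D\<in>\<D>. if D \<in> P then x ^ card P else 0)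
        = of_real (real (card P) + (real (card (nbrs c I)) - real (card I))) * x ^ card P"
      by simp
  qed simp
  also have "\<dots> = x * poly (pderiv (cpoly V)) x
      + of_real (real (card (nbrs c I)) - real (card I)) * poly (cpoly V) x"
    unfolding poly_pderiv_cpoly
    by (simp add: poly_cpoly sum_distrib_left sum.distrib algebra_simps sum_subtractf)
  finally show ?thesis
    by (simp add: algebra_simps)
qed

lemma clique_partitions_singletons: "(\<lambda>u. {u}) ` V \<in> clique_partitions V"
  by (auto simp: clique_partitions_def clique_def intro: partition_on_singletons)

text \<open>All coefficients are nonnegative and the partition into singletons exists. Real zeros
  are therefore nonpositive, as \<open>nonpos_roots_shift_pderiv\<close> requires.\<close>

lemma poly_cpoly_pos:
  assumes fin: "finite V" and "r > 0"
  shows "poly (cpoly V) (of_real r) \<noteq> 0"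
proof -
  have "(\<Sum>P\<in>clique_partitions V. r ^ card P) > 0"
    using fin \<open>r > 0\<close> clique_partitions_singletons[of V] finite_clique_partitions[OF fin]
    by (intro sum_pos) auto
  moreover have "poly (cpoly V) (of_real r) = of_real (\<Sum>P\<in>clique_partitions V. r ^ card P)"
    by (simp add: poly_cpoly)
  ultimately show ?thesis
    by (metis of_real_eq_0_iff less_irrefl)
qed

lemma real_rooted_insert_simplicial:
  assumes fin: "finite V" and c: "c \<notin> V" and I: "I \<subseteq> V" "coclique I"
    and full: "\<And>u. u \<in> V - I \<Longrightarrow> adj c u"
    and rr: "real_rooted V"
  shows "real_rooted (insert c V)"
  unfolding real_rooted_def
proof (intro allI impI)
  fix x assume "poly (cpoly (insert c V)) x = 0"
  then have root: "(x + of_real (real (card (nbrs c I)) - real (card I))) * poly (cpoly V) x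
      + x * poly (pderiv (cpoly V)) x = 0"
    using cpoly_insert_simplicial[OF fin c I full, of x] by simp
  have nonzero: "cpoly V \<noteq> 0"
    using poly_cpoly_pos[OF fin, of 1] by auto
  have "z \<in> \<real>\<^sub>\<le>\<^sub>0" if z: "poly (cpoly V) z = 0" for z
  proof -
    obtain r where r: "z = of_real r"
      using z rr by (auto simp: real_rooted_def elim: Reals_cases)
    then show ?thesis
      using z poly_cpoly_pos[OF fin, of r] by (cases "r > 0") auto
  qed
  then show "x \<in> \<real>"
    using nonpos_roots_shift_pderiv[OF nonzero _ root] by blast
qed

section \<open>Cliques over a coclique\<close>

lemma cpoly_coclique:
  assumes "finite I" "coclique I"
  shows "cpoly I = monom 1 (card I)"
proof -
  have "P = (\<lambda>u. {u}) ` I" if "P \<in> clique_partitions I" for P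
  proof -
    have part: "partition_on I P" and cl: "\<And>B. B \<in> P \<Longrightarrow> clique B"
      using that by (auto simp: clique_partitions_def)
    have single: "B = {u}" if "B \<in> P" "u \<in> B" for B u
      using clique_Int_coclique[OF assms(2) _ cl[OF that(1)] that(2)] that
        partition_onD1[OF part] by auto
    show ?thesis
    proof
      show "P \<subseteq> (\<lambda>u. {u}) ` I"
      proof
        fix B assume B: "B \<in> P"
        then obtain u where "u \<in> B"
          using partition_onD3[OF part] by (cases "B = {}") auto
        then show "B \<in> (\<lambda>u. {u}) ` I"
          using single[OF B] B partition_onD1[OF part] by blast
      qed
      show "(\<lambda>u. {u}) ` I \<subseteq> P"
        using single partition_onD1[OF part] by blast
    qed
  qed
  then have "clique_partitions I = {(\<lambda>u. {u}) ` I}"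
    using clique_partitions_singletons by blast
  then show ?thesis
    by (simp add: cpoly_def card_image)
qed

lemma real_rooted_coclique: "finite I \<Longrightarrow> coclique I \<Longrightarrow> real_rooted I"
  by (auto simp: real_rooted_def cpoly_coclique poly_monom)

lemma coclique_subset: "coclique B \<Longrightarrow> A \<subseteq> B \<Longrightarrow> coclique A"
  by (auto simp: coclique_def)

text \<open>With m = \<open>card I\<close>, the rule x (x^m)' = m x^m cancels the term -m of
  \<open>cpoly_insert_simplicial\<close>. On the cofactor of x^m the operator becomes q \<mapsto> (x
  + g) q + x q', where g is the number of neighbours of \<open>c\<close> in
  \<open>I\<close>.\<close>

lemma cpoly_insert_simplicial_factor:
  assumes fin: "finite V" and c: "c \<notin> V" and I: "I \<subseteq> V" "coclique I"
    and full: "\<And>u. u \<in> V - I \<Longrightarrow> adj c u"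
    and V: "cpoly V = monom 1 (card I) * q"
  shows "cpoly (insert c V) =
    monom 1 (card I) * ([:of_nat (card (nbrs c I)), 1:] * q + [:0, 1:] * pderiv q)"
proof -
  have id: "(x + (g - m)) * (e * Q) + x * (e * Q' + Q * d) = e * ((g + x) * Q + x * Q')"
    if "x * d = m * e" for x d g m e Q Q' :: complex
    using that by algebra
  have "poly (cpoly (insert c V)) =
      poly (monom 1 (card I) * ([:of_nat (card (nbrs c I)), 1:] * q + [:0, 1:] * pderiv q))"
  proof
    fix x :: complex
    define d g m where "d = poly (pderiv (monom (1::complex) (card I))) x"
      and "g = (of_nat (card (nbrs c I)) :: complex)" and "m = (of_nat (card I) :: complex)"
    have d: "x * d = m * x ^ card I"
      unfolding d_def m_def by (cases "card I") (simp_all add: pderiv_monom poly_monom monom_0)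
    have "poly (cpoly (insert c V)) x = (x + (g - m)) * (x ^ card I * poly q x)
        + x * (x ^ card I * poly (pderiv q) x + poly q x * d)"
      using cpoly_insert_simplicial[OF fin c I full, of x]
      by (simp add: V pderiv_mult poly_monom d_def g_def m_def)
    also note id[OF d]
    finally show "poly (cpoly (insert c V)) x =
        poly (monom 1 (card I) * ([:of_nat (card (nbrs c I)), 1:] * q + [:0, 1:] * pderiv q)) x"
      unfolding poly_mult poly_add poly_monom g_def by simp
  qed
  then show ?thesis
    by (simp only: poly_eq_poly_eq_iff)
qed

text \<open>This lemma and the next two iterate the operator on cofactors, starting from q = 1 for
  the coclique alone.\<close>

lemma cpoly_clique1:
  assumes I: "finite I" "coclique I" and "a \<notin> I"
  shows "cpoly (insert a I) = monom 1 (card I) * [:of_nat (card (nbrs a I)), 1:]"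
proof -
  have "cpoly (insert a I) = monom 1 (card I) * ([:of_nat (card (nbrs a I)), 1:] * 1 + [:0, 1:] * pderiv 1)"
    by (rule cpoly_insert_simplicial_factor) (use assms in \<open>auto simp: cpoly_coclique\<close>)
  then show ?thesis
    by simp
qed

lemma cpoly_clique2:
  assumes I: "finite I" "coclique I" and ab: "a \<notin> I" "b \<notin> I" "a \<noteq> b" "adj a b"
  shows "cpoly (insert a (insert b I)) = monom 1 (card I) *
    [:of_nat (card (nbrs a I) * card (nbrs b I)), of_nat (card (nbrs a I) + card (nbrs b I) + 1), 1:]"
proof -
  have "cpoly (insert a (insert b I)) = monom 1 (card I) *
      ([:of_nat (card (nbrs a I)), 1:] * [:of_nat (card (nbrs b I)), 1:]
        + [:0, 1:] * pderiv [:of_nat (card (nbrs b I)), 1:])"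
    by (rule cpoly_insert_simplicial_factor) (use assms cpoly_clique1 in auto)
  then show ?thesis
    by (simp add: pderiv_pCons algebra_simps)
qed

lemma cpoly_clique3:
  fixes I :: "'a set"
  defines "\<alpha> \<equiv> \<lambda>u. of_nat (card (nbrs u I))"
  assumes I: "finite I" "coclique I" and abc: "a \<notin> I" "b \<notin> I" "c \<notin> I"
    "a \<noteq> b" "a \<noteq> c" "b \<noteq> c" "adj a b" "adj a c" "adj b c"
  shows "cpoly (insert a (insert b (insert c I))) = monom 1 (card I) *
    [:\<alpha> a * \<alpha> b * \<alpha> c, \<alpha> a * \<alpha> b + \<alpha> a * \<alpha> c + \<alpha> b * \<alpha> c + \<alpha> a + \<alpha> b + \<alpha> c + 1,
      \<alpha> a + \<alpha> b + \<alpha> c + 3, 1:]"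
proof -
  have "cpoly (insert b (insert c I)) = monom 1 (card I) * [:\<alpha> b * \<alpha> c, \<alpha> b + \<alpha> c + 1, 1:]"
    using cpoly_clique2[OF I abc(2,3,6,9)] by (simp only: \<alpha>_def of_nat_add of_nat_mult of_nat_1)
  then have "cpoly (insert a (insert b (insert c I))) = monom 1 (card I) *
      ([:\<alpha> a, 1:] * [:\<alpha> b * \<alpha> c, \<alpha> b + \<alpha> c + 1, 1:]
        + [:0, 1:] * pderiv [:\<alpha> b * \<alpha> c, \<alpha> b + \<alpha> c + 1, 1:])"
    unfolding \<alpha>_def by (intro cpoly_insert_simplicial_factor) (use I abc in auto)
  then show ?thesis
    by (simp add: pderiv_pCons algebra_simps)
qed

text \<open>Starting from a power of x, the vertices of \<open>W\<close> are added one at a time,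
  each adjacent to all earlier ones.\<close>

lemma real_rooted_clique_Un_coclique:
  assumes I: "finite I" "coclique I" and W: "finite W" "W \<inter> I = {}" "clique W"
  shows "real_rooted (W \<union> I)"
  using W
proof (induction W rule: finite_induct)
  case empty
  then show ?case using I by (simp add: real_rooted_coclique)
next
  case (insert c W)
  have "real_rooted (insert c (W \<union> I))"
  proof (rule real_rooted_insert_simplicial[where I = I])
    show "real_rooted (W \<union> I)"
      using insert by (auto simp: clique_def)
  qed (use insert I in \<open>auto simp: clique_def\<close>)
  then show ?case by simp
qed

text \<open>All neighbours of \<open>v\<close> lie in the coclique, so the recurrence of
  \<open>cpoly_coclique_nbrs\<close> applies. Deleting \<open>l\<close> from \<open>I\<close> loses
  one power of x, which the factor x of the recurrence restores.\<close>

lemma cpoly_add_vertex: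
  assumes fin: "finite W" "finite I" and I: "coclique I" "W \<inter> I = {}"
    and v: "v \<notin> W" "v \<notin> I" "nbrs v W = {}"
    and F: "\<And>J. J \<subseteq> I \<Longrightarrow> poly (cpoly (W \<union> J)) x = x ^ card J * F J"
  shows "poly (cpoly (insert v (W \<union> I))) x = x ^ card I * (x * F I + (\<Sum>l\<in>nbrs v I. F (I - {l})))"
proof -
  have N: "nbrs v (W \<union> I) = nbrs v I"
    using v(3) by (auto simp: nbrs_def)
  have "poly (cpoly (insert v (W \<union> I))) x = x * poly (cpoly (W \<union> I)) x
      + (\<Sum>l\<in>nbrs v I. x * poly (cpoly (W \<union> I - {l})) x)"
    using cpoly_coclique_nbrs[of "W \<union> I" v x] fin v I(1) unfolding N
    by (auto intro: coclique_subset simp: nbrs_def)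
  also have "(\<Sum>l\<in>nbrs v I. x * poly (cpoly (W \<union> I - {l})) x) = (\<Sum>l\<in>nbrs v I. x ^ card I * F (I - {l}))"
  proof (rule sum.cong)
    fix l assume "l \<in> nbrs v I"
    then have l: "l \<in> I"
      by (simp add: nbrs_def)
    have "W \<union> I - {l} = W \<union> (I - {l})"
      using l I(2) by auto
    moreover have "x * x ^ card (I - {l}) = x ^ card I"
      using card_Suc_Diff1[OF fin(2) l] by (metis power_Suc)
    ultimately show "x * poly (cpoly (W \<union> I - {l})) x = x ^ card I * F (I - {l})"
      using F[of "I - {l}"] by (simp add: mult.assoc[symmetric])
  qed simp
  finally show ?thesis
    using F[of I] by (simp add: sum_distrib_left algebra_simps)
qed

lemma real_card_nbrs_remove:
  assumes "finite I" "l \<in> I"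
  shows "real (card (nbrs a (I - {l}))) = real (card (nbrs a I)) - (if adj a l then 1 else 0)"
proof -
  have "nbrs a (I - {l}) = nbrs a I - {l}"
    by (auto simp: nbrs_def)
  moreover have "card (nbrs a I) \<noteq> 0" "l \<in> nbrs a I" if "adj a l"
    using assms that by (auto simp: nbrs_def)
  moreover have "nbrs a I - {l} = nbrs a I" if "\<not> adj a l"
    using that by (auto simp: nbrs_def)
  ultimately show ?thesis
    by (cases "adj a l") (simp_all add: card_Diff_singleton of_nat_diff)
qed

text \<open>An adjacent pair is a clique over a coclique. Otherwise, at -\<alpha>(I) the leading
  product of the quadratic vanishes and each summand is \<alpha>(I - {l}) - \<alpha>(I) \<le>
  0.\<close>

lemma real_rooted_pair:
  assumes I: "finite I" "coclique I" and av: "a \<notin> I" "v \<notin> I" "a \<noteq> v"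
  shows "real_rooted (insert a (insert v I))"
proof (cases "adj v a")
  case True
  then have "clique {a, v}"
    using adj_sym by (auto simp: clique_def)
  then show ?thesis
    using real_rooted_clique_Un_coclique[OF I, of "{a, v}"] av by simp
next
  case False
  define \<alpha> where "\<alpha> J = card (nbrs a J)" for J
  define L where "L = nbrs v I"
  have S: "poly (cpoly (insert v ({a} \<union> I))) x =
      x ^ card I * (x * (x + of_nat (\<alpha> I)) + (\<Sum>l\<in>L. x + of_nat (\<alpha> (I - {l}))))" for x
    unfolding L_def
  proof (rule cpoly_add_vertex)
    fix J assume J: "J \<subseteq> I"
    then have "finite J" "coclique J" "a \<notin> J"
      using I av by (auto intro: finite_subset coclique_subset)
    then show "poly (cpoly ({a} \<union> J)) x = x ^ card J * (x + of_nat (\<alpha> J))"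
      by (simp add: cpoly_clique1 poly_monom \<alpha>_def algebra_simps)
  qed (use I av False in \<open>auto simp: nbrs_def\<close>)
  have "x \<in> \<real>" if x: "poly (cpoly (insert v ({a} \<union> I))) x = 0" for x
  proof (cases "x = 0")
    case False
    define b c where "b = real (\<alpha> I) + real (card L)" and "c = (\<Sum>l\<in>L. real (\<alpha> (I - {l})))"
    show ?thesis
    proof (rule real_quadratic_root_real)
      show "x^2 + of_real b * x + of_real c = 0"
      proof -
        have "x * (x + of_nat (\<alpha> I)) + (\<Sum>l\<in>L. x + of_nat (\<alpha> (I - {l}))) = 0"
          using x False unfolding S by simp
        then show ?thesis
          by (simp add: b_def c_def sum.distrib power2_eq_square algebra_simps)
      qed
      have "\<alpha> (I - {l}) \<le> \<alpha> I" for l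
        unfolding \<alpha>_def using I by (intro card_mono) (auto simp: nbrs_def)
      then have "c \<le> real (card L) * real (\<alpha> I)"
        unfolding c_def using sum_bounded_above[of L "\<lambda>l. real (\<alpha> (I - {l}))" "real (\<alpha> I)"] by simp
      then show "(- real (\<alpha> I))^2 + b * (- real (\<alpha> I)) + c \<le> 0"
        by (simp add: b_def power2_eq_square algebra_simps)
    qed
  qed simp
  then show ?thesis
    by (simp add: real_rooted_def insert_commute)
qed

section \<open>Triangle-free graphs\<close>

text \<open>Heilmann and Lieb: for a triangle-free graph the clique partitions are the matchings. With
  \<open>x = w\<^sup>2\<close>, the vertex recurrence says that the quotient of the values at \<open>V\<close> and \<open>V - {v}\<close>,
  divided by \<open>w\<close>, is \<open>w\<close> plus a sum of inverses of such numbers, so that it stays in the right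
  half-plane.\<close>

lemma triangle_free_half_plane:
  assumes "finite V" and "\<And>v. v \<in> V \<Longrightarrow> coclique (nbrs v V)" and w: "Re w > 0"
  shows "poly (cpoly V) (w^2) \<noteq> 0 \<and>
    (\<forall>v\<in>V. Re (poly (cpoly V) (w^2) / (w * poly (cpoly (V - {v})) (w^2))) > 0)"
  using assms(1,2)
proof (induction V rule: finite_psubset_induct)
  case (psubset V)
  define S where "S A = poly (cpoly A) (w^2)" for A
  have w0: "w \<noteq> 0"
    using w by auto
  have IH: "S A \<noteq> 0 \<and> (\<forall>u\<in>A. Re (S A / (w * S (A - {u}))) > 0)" if "A \<subset> V" for A
    unfolding S_def
  proof (rule psubset.IH[OF that])
    fix v assume "v \<in> A"
    then show "coclique (nbrs v A)"
      using that psubset.prems[of v] by (auto intro: coclique_subset simp: nbrs_def)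
  qed
  have quot: "Re (S V / (w * S (V - {v}))) > 0" if v: "v \<in> V" for v
  proof -
    define U where "U = V - {v}"
    have U: "U \<subset> V" "finite U" "v \<notin> U" "insert v U = V"
      using v psubset.hyps by (auto simp: U_def)
    have SU: "S U \<noteq> 0"
      using IH[OF U(1)] by blast
    have "coclique (nbrs v U)"
      using psubset.prems[OF v] by (rule coclique_subset) (auto simp: U_def nbrs_def)
    then have "S V = w^2 * S U + (\<Sum>u\<in>nbrs v U. w^2 * S (U - {u}))"
      using cpoly_coclique_nbrs[OF U(2,3), of "w^2"] U(4) by (simp add: S_def)
    then have "S V / (w * S U) = w + (\<Sum>u\<in>nbrs v U. w^2 * S (U - {u}) / (w * S U))"
      using w0 SU by (simp add: add_divide_distrib sum_divide_distrib power2_eq_square)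
    also have "\<dots> = w + (\<Sum>u\<in>nbrs v U. inverse (S U / (w * S (U - {u}))))"
      using w0 by (simp add: power2_eq_square)
    finally have eq: "S V / (w * S U) = \<dots>" .
    have "Re (inverse (S U / (w * S (U - {u})))) \<ge> 0" if "u \<in> nbrs v U" for u
    proof -
      have "Re (S U / (w * S (U - {u}))) > 0"
        using IH[OF U(1)] that by (auto simp: nbrs_def)
      then show ?thesis
        by (simp only: inverse_complex.sel) (simp add: divide_nonneg_nonneg)
    qed
    then have "(\<Sum>u\<in>nbrs v U. Re (inverse (S U / (w * S (U - {u}))))) \<ge> 0"
      by (rule sum_nonneg)
    then show ?thesis
      using w eq unfolding U_def by (simp only: plus_complex.sel Re_sum)
  qed
  \<comment> \<open>A zero value would make the quotient at any vertex 0, whose real part is not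
    positive; for the empty set the polynomial is 1.\<close>
  have "S V \<noteq> 0"
  proof (cases "V = {}")
    case True
    then show ?thesis
      by (simp add: S_def cpoly_coclique coclique_def poly_monom)
  next
    case False
    then obtain v where "v \<in> V"
      by auto
    then show ?thesis
      using quot[of v] by auto
  qed
  then show ?case
    using quot by (simp add: S_def)
qed

text \<open>The principal square root of a zero has nonnegative real part, and a positive one is
  excluded. So it is purely imaginary and its square is real.\<close>

lemma real_rooted_triangle_free:
  assumes "finite V" and "\<And>v. v \<in> V \<Longrightarrow> coclique (nbrs v V)"
  shows "real_rooted V"
  unfolding real_rooted_def
proof (intro allI impI)
  fix x assume x: "poly (cpoly V) x = 0"
  have "\<not> Re (csqrt x) > 0"
    using triangle_free_half_plane[OF assms, of "csqrt x"] x by auto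
  then have "Re (csqrt x) = 0"
    using csqrt_principal[of x] by auto
  then have "Im ((csqrt x)^2) = 0"
    by (simp only: Im_power2)
  then show "x \<in> \<real>"
    by (simp add: complex_is_Real_iff)
qed

section \<open>Graphs with a triangle\<close>

text \<open>The two zeros of \<open>(x + \<alpha>) (x + \<beta>) + x\<close>, which belongs to the edge \<open>a b\<close>, separate
  the zeros of the cubic: passing to \<open>I - {l}\<close> lowers \<open>\<alpha>\<close> and \<open>\<beta>\<close> by at most one each, which
  raises the quadratic at its smaller zero and lowers it at the larger one.\<close>

lemma real_rooted_edge_and_vertex:
  assumes I: "finite I" "coclique I" and abv: "a \<notin> I" "b \<notin> I" "v \<notin> I" "a \<noteq> b" "v \<noteq> a" "v \<noteq> b"
    and adj: "adj a b" "\<not> adj v a" "\<not> adj v b"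
  shows "real_rooted (insert a (insert b (insert v I)))"
proof -
  define \<alpha> \<beta> where "\<alpha> J = card (nbrs a J)" and "\<beta> J = card (nbrs b J)" for J
  define L where "L = nbrs v I"
  have L: "l \<in> I" if "l \<in> L" for l
    using that by (simp add: L_def nbrs_def)
  have S: "poly (cpoly (insert v ({a, b} \<union> I))) x = x ^ card I *
      (x * (x^2 + of_nat (\<alpha> I + \<beta> I + 1) * x + of_nat (\<alpha> I * \<beta> I)) +
       (\<Sum>l\<in>L. x^2 + of_nat (\<alpha> (I - {l}) + \<beta> (I - {l}) + 1) * x + of_nat (\<alpha> (I - {l}) * \<beta> (I - {l}))))"
    for x
    unfolding L_def
  proof (rule cpoly_add_vertex)
    fix J assume J: "J \<subseteq> I"
    then have "finite J" "coclique J" "a \<notin> J" "b \<notin> J"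
      using I abv by (auto intro: finite_subset coclique_subset)
    then have "cpoly (insert a (insert b J)) = monom 1 (card J) * [:of_nat (\<alpha> J * \<beta> J), of_nat (\<alpha> J + \<beta> J + 1), 1:]"
      unfolding \<alpha>_def \<beta>_def using abv adj by (intro cpoly_clique2) auto
    moreover have "{a, b} \<union> J = insert a (insert b J)"
      by auto
    ultimately show "poly (cpoly ({a, b} \<union> J)) x
        = x ^ card J * (x^2 + of_nat (\<alpha> J + \<beta> J + 1) * x + of_nat (\<alpha> J * \<beta> J))"
      by (simp only: poly_mult poly_monom) (simp add: power2_eq_square algebra_simps)
  qed (use I abv adj in \<open>auto simp: nbrs_def\<close>)
  define p q where "p = real (\<alpha> I)" and "q = real (\<beta> I)"
  define A B where "A = p + q + 1" and "B = p * q"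
  define f g where "f l = real (\<alpha> (I - {l}) + \<beta> (I - {l}) + 1)"
    and "g l = real (\<alpha> (I - {l}) * \<beta> (I - {l}))" for l
  define \<epsilon> \<eta> where "\<epsilon> l = (if adj a l then 1 else 0 :: real)" and "\<eta> l = (if adj b l then 1 else 0 :: real)" for l
  have pq: "p \<ge> 0" "q \<ge> 0"
    by (simp_all add: p_def q_def)
  have quad: "t^2 + f l * t + g l = (t + p - \<epsilon> l) * (t + q - \<eta> l) + t" if "l \<in> L" for t l
  proof -
    have eqs: "real (\<alpha> (I - {l})) = p - \<epsilon> l" "real (\<beta> (I - {l})) = q - \<eta> l"
      using real_card_nbrs_remove[OF I(1) L[OF that]]
      by (simp_all add: \<alpha>_def \<beta>_def p_def q_def \<epsilon>_def \<eta>_def)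
    show ?thesis
      unfolding f_def g_def of_nat_add of_nat_mult eqs by (simp add: power2_eq_square algebra_simps)
  qed
  \<comment> \<open>The radicand is the discriminant A^2 - 4B, so \<open>u\<close> and
    \<open>w\<close> are the zeros of the quadratic belonging to the edge.\<close>
  define D where "D = sqrt ((p - q)^2 + 2 * (p + q) + 1)"
  define u w where "u = (- A - D) / 2" and "w = (- A + D) / 2"
  have D2: "D^2 = (p - q)^2 + 2 * (p + q) + 1"
    using pq by (simp add: D_def)
  have D1: "D \<ge> 1"
    using pq by (simp add: D_def)
  have "D \<ge> \<bar>p - q\<bar>"
    unfolding D_def using pq by (intro real_le_rsqrt) simp
  have roots: "u^2 + A * u + B = 0" "w^2 + A * w + B = 0"
    using D2 unfolding u_def w_def A_def B_def by (simp_all add: field_simps power2_eq_square)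
  have u_neg: "u + p \<le> 0" "u + q \<le> 0"
    using \<open>D \<ge> \<bar>p - q\<bar>\<close> unfolding u_def A_def by (simp_all add: field_simps)
  \<comment> \<open>The extra 1 compensates the 1 in \<open>A\<close>, which the larger zero needs
    but the smaller one does not.\<close>
  have "D \<ge> \<bar>p - q\<bar> + 1"
  proof (rule power2_le_imp_le)
    have "\<bar>p - q\<bar> \<le> p + q"
      using pq by (simp add: abs_le_iff)
    then show "(\<bar>p - q\<bar> + 1)^2 \<le> D^2"
      unfolding D2 by (simp add: power2_sum)
  qed (use D1 in simp)
  then have w_pos: "w + p \<ge> 0" "w + q \<ge> 0"
    unfolding w_def A_def by (simp_all add: field_simps)
  \<comment> \<open>If \<open>l\<close> is adjacent to both \<open>a\<close> and \<open>b\<close>,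
    the value at \<open>w\<close> is 1 - (w + p) - (w + q). The sum in question equals D - 1, and p,
    q \<ge> 1 give D \<ge> 2.\<close>
  have w_sum: "w + p + (w + q) \<ge> 1" if "\<epsilon> l = 1" "\<eta> l = 1" "l \<in> L" for l
  proof -
    have "l \<in> nbrs a I" "l \<in> nbrs b I"
      using that L by (auto simp: \<epsilon>_def \<eta>_def nbrs_def split: if_splits)
    then have "\<alpha> I \<ge> 1" "\<beta> I \<ge> 1"
      using finite_nbrs[OF I(1)] by (auto simp: \<alpha>_def \<beta>_def Suc_le_eq card_gt_0_iff)
    then have "p \<ge> 1" "q \<ge> 1"
      by (simp_all add: p_def q_def)
    then have "0 + 2 * (1 + 1) + 1 \<le> D^2"
      unfolding D2 by (intro add_mono mult_left_mono) simp_all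
    then have "2 \<le> D"
      using D1 by (simp add: power2_le_imp_le[of 2 D])
    then show ?thesis
      by (simp add: w_def A_def field_simps)
  qed
  have "u < w"
    using D1 by (simp add: u_def w_def)
  have uw_roots: "(u + p) * (u + q) + u = 0" "(w + p) * (w + q) + w = 0"
    using roots by (simp_all add: A_def B_def power2_eq_square algebra_simps)
  \<comment> \<open>At a zero t of the edge quadratic the value is -\<epsilon>(t + q) - \<eta>(t +
    p) + \<epsilon>\<eta>; only at \<open>w\<close> does the last term have the wrong sign.\<close>
  have at_u: "u^2 + f l * u + g l \<ge> 0" if "l \<in> L" for l
    using quad[OF that, of u] uw_roots(1) u_neg
    by (cases "adj a l"; cases "adj b l") (simp_all add: \<epsilon>_def \<eta>_def algebra_simps)
  have at_w: "w^2 + f l * w + g l \<le> 0" if "l \<in> L" for l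
    using quad[OF that, of w] uw_roots(2) w_pos w_sum[OF _ _ that]
    by (cases "adj a l"; cases "adj b l") (simp_all add: \<epsilon>_def \<eta>_def algebra_simps)
  have "x \<in> \<real>" if x: "poly (cpoly (insert v ({a, b} \<union> I))) x = 0" for x
  proof (cases "x = 0")
    case False
    show ?thesis
    proof (rule real_cubic_sum_root_real[OF _ \<open>u < w\<close>])
      show "x * (x^2 + of_real A * x + of_real B) + (\<Sum>l\<in>L. x^2 + of_real (f l) * x + of_real (g l)) = 0"
        using x False unfolding S by (simp add: A_def B_def p_def q_def f_def g_def ac_simps)
      show "u * (u^2 + A * u + B) + (\<Sum>l\<in>L. u^2 + f l * u + g l) \<ge> 0"
        using at_u by (simp add: roots sum_nonneg)
      show "w * (w^2 + A * w + B) + (\<Sum>l\<in>L. w^2 + f l * w + g l) \<le> 0"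
        using at_w by (simp add: roots sum_nonpos)
    qed
  qed simp
  moreover have "insert v ({a, b} \<union> I) = insert a (insert b (insert v I))"
    by auto
  ultimately show ?thesis
    by (simp add: real_rooted_def)
qed

section \<open>A triangle, a vertex and a coclique\<close>

text \<open>As \<open>c\<close> is adjacent to \<open>a\<close>, \<open>b\<close> and
  \<open>v\<close>, it can be added last. Among the rest, a vertex of the edge adjacent to
  \<open>v\<close> can be added last in the same way; if there is none,
  \<open>real_rooted_edge_and_vertex\<close> applies.\<close>

lemma real_rooted_triangle_adjacent_vertex:
  assumes I: "finite I" "coclique I" and notin: "a \<notin> I" "b \<notin> I" "c \<notin> I" "v \<notin> I"
    and dist: "a \<noteq> b" "a \<noteq> c" "b \<noteq> c" "v \<noteq> a" "v \<noteq> b" "v \<noteq> c"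
    and tri: "adj a b" "adj a c" "adj b c" and v: "adj v c"
  shows "real_rooted (insert a (insert b (insert c (insert v I))))"
proof -
  have rr: "real_rooted (insert a (insert b (insert v I)))"
  proof (cases "\<not> adj v a \<and> \<not> adj v b")
    case True
    then show ?thesis
      using I notin dist tri by (intro real_rooted_edge_and_vertex) auto
  next
    case False
    then consider "adj a v" | "adj b v"
      using adj_sym by blast
    then show ?thesis
    proof cases
      case 1
      show ?thesis
        by (rule real_rooted_insert_simplicial[where I = I])
          (use 1 I notin dist tri real_rooted_pair[of I b v] in auto)
    next
      case 2
      have "real_rooted (insert b (insert a (insert v I)))"
        by (rule real_rooted_insert_simplicial[where I = I])
          (use 2 I notin dist tri adj_sym real_rooted_pair[of I a v] in auto)
      then show ?thesis
        by (simp add: insert_commute)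
    qed
  qed
  have "real_rooted (insert c (insert a (insert b (insert v I))))"
    by (rule real_rooted_insert_simplicial[where I = I, OF _ _ _ _ _ rr])
      (use I notin dist tri v adj_sym in auto)
  then show ?thesis
    by (simp add: insert_commute)
qed

text \<open>The case of \<open>cpoly_add_vertex\<close> in which \<open>F\<close> is the cubic
  cofactor from \<open>cpoly_clique3\<close>.\<close>

lemma cpoly_triangle_and_vertex:
  fixes I :: "'a set"
  defines "\<alpha> \<equiv> \<lambda>u J. of_nat (card (nbrs u J))"
  defines "F \<equiv> \<lambda>x a b c J. x^3 + (\<alpha> a J + \<alpha> b J + \<alpha> c J + 3) * x^2
      + (\<alpha> a J * \<alpha> b J + \<alpha> a J * \<alpha> c J + \<alpha> b J * \<alpha> c J + \<alpha> a J + \<alpha> b J + \<alpha> c J + 1) * x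
      + \<alpha> a J * \<alpha> b J * \<alpha> c J"
  assumes I: "finite I" "coclique I" and notin: "a \<notin> I" "b \<notin> I" "c \<notin> I" "v \<notin> I"
    and dist: "a \<noteq> b" "a \<noteq> c" "b \<noteq> c" "v \<noteq> a" "v \<noteq> b" "v \<noteq> c"
    and tri: "adj a b" "adj a c" "adj b c" and v: "\<not> adj v a" "\<not> adj v b" "\<not> adj v c"
  shows "poly (cpoly (insert a (insert b (insert c (insert v I))))) x =
    x ^ card I * (x * F x a b c I + (\<Sum>l\<in>nbrs v I. F x a b c (I - {l})))"
proof -
  have "poly (cpoly (insert v ({a, b, c} \<union> I))) x =
      x ^ card I * (x * F x a b c I + (\<Sum>l\<in>nbrs v I. F x a b c (I - {l})))"
  proof (rule cpoly_add_vertex)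
    fix J assume J: "J \<subseteq> I"
    then have "finite J" "coclique J" "a \<notin> J" "b \<notin> J" "c \<notin> J"
      using I notin by (auto intro: finite_subset coclique_subset)
    then have "cpoly (insert a (insert b (insert c J))) = monom 1 (card J) *
        [:\<alpha> a J * \<alpha> b J * \<alpha> c J, \<alpha> a J * \<alpha> b J + \<alpha> a J * \<alpha> c J + \<alpha> b J * \<alpha> c J + \<alpha> a J + \<alpha> b J + \<alpha> c J + 1,
          \<alpha> a J + \<alpha> b J + \<alpha> c J + 3, 1:]"
      unfolding \<alpha>_def using dist tri by (intro cpoly_clique3) auto
    moreover have "{a, b, c} \<union> J = insert a (insert b (insert c J))"
      by auto
    ultimately show "poly (cpoly ({a, b, c} \<union> J)) x = x ^ card J * F x a b c J"
      by (simp only: poly_mult poly_monom) (simp add: F_def power2_eq_square power3_eq_cube algebra_simps)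
  qed (use I notin dist v in \<open>auto simp: nbrs_def\<close>)
  moreover have "insert v ({a, b, c} \<union> I) = insert a (insert b (insert c (insert v I)))"
    by auto
  ultimately show ?thesis
    by simp
qed

text \<open>Deleting any neighbour of \<open>v\<close> leaves some triangle vertex without
  neighbours in \<open>I\<close>. Hence the quartic cofactor has constant term 0, and a cubic
  remains whose sign change is explicit.\<close>

lemma real_rooted_pendant_triangle:
  assumes I: "finite I" "coclique I" and notin: "a \<notin> I" "b \<notin> I" "c \<notin> I" "v \<notin> I"
    and dist: "a \<noteq> b" "a \<noteq> c" "b \<noteq> c" "v \<noteq> a" "v \<noteq> b" "v \<noteq> c"
    and tri: "adj a b" "adj a c" "adj b c" and v: "\<not> adj v a" "\<not> adj v b" "\<not> adj v c"
    and l: "l \<noteq> m" "nbrs a I = {l}" "nbrs b I = {m}"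
    and N: "nbrs v I = {l, m} \<or> (\<exists>k. k \<noteq> l \<and> k \<noteq> m \<and> nbrs c I = {k} \<and> nbrs v I = {l, m, k})"
  shows "real_rooted (insert a (insert b (insert c (insert v I))))"
  unfolding real_rooted_def
proof (intro allI impI)
  fix x assume x: "poly (cpoly (insert a (insert b (insert c (insert v I))))) x = 0"
  have lm: "l \<in> I" "m \<in> I" "adj a l" "adj b m" "\<not> adj a m" "\<not> adj b l"
    using l by (auto simp: nbrs_def)
  have remove: "complex_of_nat (card (nbrs u (I - {k}))) = of_nat (card (nbrs u I)) - (if adj u k then 1 else 0)"
    if "k \<in> I" for u k
    using arg_cong[OF real_card_nbrs_remove[OF I(1) that, of u], of complex_of_real] by simp
  have [simp]: "card (nbrs a I) = 1" "card (nbrs b I) = 1"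
    using l by simp_all
  show "x \<in> \<real>"
  proof (cases "x = 0")
    case False
    have cancel: "E = 0" if "x ^ card I * E = 0" for E
      using that False by simp
    note expansion = cancel[OF x[unfolded cpoly_triangle_and_vertex[OF I notin dist tri v]]]
    show ?thesis
      using N
    proof
      assume N: "nbrs v I = {l, m}"
      define g \<epsilon> where "g = real (card (nbrs c I))"
        and "\<epsilon> = (if adj c l then 1 else 0) + (if adj c m then 1 else 0 :: real)"
      have "x * (x ^ 3 + of_real (7 + g) * x ^ 2 + of_real (12 + 5 * g - \<epsilon>) * x + of_real (5 * g + 4 - 2 * \<epsilon>)) = 0"
        using expansion False l(1)
        by (cases "adj c l"; cases "adj c m")
          (simp_all add: N remove lm g_def \<epsilon>_def power2_eq_square power3_eq_cube algebra_simps)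
      then have root: "x ^ 3 + of_real (7 + g) * x ^ 2 + of_real (12 + 5 * g - \<epsilon>) * x + of_real (5 * g + 4 - 2 * \<epsilon>) = 0"
        using False by simp
      show ?thesis
        \<comment> \<open>The values are g + 2\<epsilon> + 4 at -4 and -g at -2.\<close>
        by (rule real_cubic_root_real[OF root, of "-4" "-2"]) (simp_all add: g_def \<epsilon>_def)
    next
      assume "\<exists>k. k \<noteq> l \<and> k \<noteq> m \<and> nbrs c I = {k} \<and> nbrs v I = {l, m, k}"
      then obtain k where k: "k \<noteq> l" "k \<noteq> m" "nbrs c I = {k}" "nbrs v I = {l, m, k}"
        by blast
      have kI: "k \<in> I" "adj c k" "\<not> adj c l" "\<not> adj c m" "\<not> adj a k" "\<not> adj b k"
        using k l lm by (auto simp: nbrs_def)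
      have "x * (x ^ 3 + of_real 9 * x ^ 2 + of_real 22 * x + of_real 13) = 0"
        using expansion False l(1) k(1,2)
        by (simp add: k(3,4) remove lm kI power2_eq_square power3_eq_cube algebra_simps)
      then have root: "x ^ 3 + of_real 9 * x ^ 2 + of_real 22 * x + of_real 13 = 0"
        using False by simp
      show ?thesis
        \<comment> \<open>The values are 1 at -3 and -1 at -1.\<close>
        by (rule real_cubic_root_real[OF root, of "-3" "-1"]) simp_all
    qed
  qed simp
qed

text \<open>Unless some vertex of the triangle or \<open>v\<close> has no neighbour in
  \<open>I\<close>, \<open>star\<close> makes each neighbour of \<open>v\<close> the only neighbour
  in \<open>I\<close> of some triangle vertex. So \<open>v\<close> has one, two or three neighbours
  in \<open>I\<close>.\<close>

lemma real_rooted_triangle_and_vertex: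
  assumes I: "finite I" "coclique I" and notin: "a \<notin> I" "b \<notin> I" "c \<notin> I" "v \<notin> I"
    and dist: "a \<noteq> b" "a \<noteq> c" "b \<noteq> c" "v \<noteq> a" "v \<noteq> b" "v \<noteq> c"
    and tri: "adj a b" "adj a c" "adj b c"
    and v: "\<not> adj v a" "\<not> adj v b" "\<not> adj v c"
    and star: "\<And>l. l \<in> nbrs v I \<Longrightarrow> nbrs a I \<subseteq> {l} \<or> nbrs b I \<subseteq> {l} \<or> nbrs c I \<subseteq> {l}"
  shows "real_rooted (insert a (insert b (insert c (insert v I))))"
proof -
  let ?V = "insert a (insert b (insert c (insert v I)))"
  \<comment> \<open>A triangle vertex \<open>r\<close> without neighbours in \<open>I\<close> joins
    the coclique, and the edge \<open>p q\<close> and \<open>v\<close> remain.\<close>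
  have isolated: "real_rooted (insert p (insert q (insert v (insert r I))))"
    if "{p, q, r} = {a, b, c}" "p \<noteq> q" "p \<noteq> r" "q \<noteq> r" "nbrs r I = {}" for p q r
  proof -
    have mem: "p \<in> {a, b, c}" "q \<in> {a, b, c}" "r \<in> {a, b, c}"
      using that(1) by blast+
    have "adj p q"
      using mem that(2) tri adj_sym by auto
    moreover have "p \<notin> I" "q \<notin> I" "r \<notin> I" "v \<noteq> p" "v \<noteq> q" "v \<noteq> r" "\<not> adj v p" "\<not> adj v q"
      using mem notin dist v by auto
    moreover have "coclique (insert r I)"
      using I(2) that(5) adj_sym adj_irrefl by (auto simp: coclique_def nbrs_def)
    ultimately show ?thesis
      using I(1) notin(4) that by (intro real_rooted_edge_and_vertex) auto
  qed
  \<comment> \<open>With a single neighbour \<open>l\<close>, the vertices \<open>v\<close> and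
    \<open>l\<close> exchange roles: \<open>v\<close> joins the coclique, and \<open>l\<close> is
    adjacent to the triangle.\<close>
  have swap: "real_rooted ?V" if N: "nbrs v I = {l}" "adj l a \<or> adj l b \<or> adj l c" for l
  proof -
    define J where "J = insert v (I - {l})"
    have l: "l \<in> I" "adj v l" "insert v I = insert l J"
      using N(1) by (auto simp: J_def nbrs_def)
    have J: "finite J" "coclique J"
      using I N(1) adj_sym adj_irrefl by (auto simp: J_def coclique_def nbrs_def)
    have out: "a \<notin> J" "b \<notin> J" "c \<notin> J" "l \<notin> J" "l \<noteq> a" "l \<noteq> b" "l \<noteq> c"
      using notin dist l by (auto simp: J_def)
    have "real_rooted (insert a (insert b (insert c (insert l J))))"
      using N(2)
    proof (elim disjE)
      assume "adj l a"
      then have "real_rooted (insert b (insert c (insert a (insert l J))))"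
        using J out dist tri adj_sym by (intro real_rooted_triangle_adjacent_vertex) auto
      then show ?thesis by (simp add: insert_commute)
    next
      assume "adj l b"
      then have "real_rooted (insert a (insert c (insert b (insert l J))))"
        using J out dist tri adj_sym by (intro real_rooted_triangle_adjacent_vertex) auto
      then show ?thesis by (simp add: insert_commute)
    next
      assume "adj l c"
      then show ?thesis
        using J out dist tri by (intro real_rooted_triangle_adjacent_vertex) auto
    qed
    then show ?thesis
      by (simp add: l(3))
  qed
  have pendant: "real_rooted (insert p (insert q (insert r (insert v I))))"
    if "{p, q, r} = {a, b, c}" "p \<noteq> q" "p \<noteq> r" "q \<noteq> r" "l \<noteq> m" "nbrs p I = {l}" "nbrs q I = {m}"
      "nbrs v I = {l, m} \<or> (\<exists>k. k \<noteq> l \<and> k \<noteq> m \<and> nbrs r I = {k} \<and> nbrs v I = {l, m, k})" for p q r l m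
  proof -
    have mem: "p \<in> {a, b, c}" "q \<in> {a, b, c}" "r \<in> {a, b, c}"
      using that(1) by blast+
    have "adj p q" "adj p r" "adj q r"
      using mem that(2-4) tri adj_sym by auto
    moreover have "p \<notin> I" "q \<notin> I" "r \<notin> I" "v \<noteq> p" "v \<noteq> q" "v \<noteq> r" "\<not> adj v p" "\<not> adj v q" "\<not> adj v r"
      using mem notin dist v by auto
    ultimately show ?thesis
      using I notin(4) that by (intro real_rooted_pendant_triangle) auto
  qed
  consider (empty) "nbrs a I = {} \<or> nbrs b I = {} \<or> nbrs c I = {}" | (none) "nbrs v I = {}"
    | (nonempty) "nbrs a I \<noteq> {}" "nbrs b I \<noteq> {}" "nbrs c I \<noteq> {}" "nbrs v I \<noteq> {}"
    by blast
  then show ?thesis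
  proof cases
    case empty
    then show ?thesis
      using isolated[of b c a] isolated[of a c b] isolated[of a b c] dist
      by (auto simp: insert_commute)
  next
    case none
    then have "coclique (insert v I)"
      using I(2) adj_sym adj_irrefl by (auto simp: coclique_def nbrs_def)
    moreover have "clique {a, b, c}"
      using tri adj_sym by (auto simp: clique_def)
    ultimately have "real_rooted ({a, b, c} \<union> insert v I)"
      using I(1) notin dist by (intro real_rooted_clique_Un_coclique) auto
    then show ?thesis
      by (simp add: insert_commute)
  next
    case nonempty
    have single: "nbrs a I = {l} \<or> nbrs b I = {l} \<or> nbrs c I = {l}" if "l \<in> nbrs v I" for l
      using star[OF that] nonempty by (simp add: subset_singleton_iff)
    obtain l where l: "l \<in> nbrs v I"
      using nonempty by blast
    show ?thesis
    proof (cases "nbrs v I = {l}")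
      case True
      have "adj l a \<or> adj l b \<or> adj l c"
        using single[OF l] adj_sym by (auto simp: nbrs_def)
      then show ?thesis
        using swap[OF True] by simp
    next
      case False
      then obtain m where m: "m \<in> nbrs v I" "m \<noteq> l"
        using l by blast
      obtain p where p: "p \<in> {a, b, c}" "nbrs p I = {l}"
        using single[OF l] by blast
      obtain q where q: "q \<in> {a, b, c}" "nbrs q I = {m}"
        using single[OF m(1)] by blast
      have "p \<noteq> q"
        using p q m(2) by auto
      then obtain r where r: "{p, q, r} = {a, b, c}" "p \<noteq> r" "q \<noteq> r"
        using p(1) q(1) dist by (elim insertE emptyE; simp; metis insert_commute)
      \<comment> \<open>\<open>p\<close> and \<open>q\<close> are taken by \<open>l\<close> and
        \<open>m\<close>, so only \<open>r\<close> is left for \<open>k\<close>; this also shows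
        that \<open>k\<close> is unique.\<close>
      have third: "nbrs r I = {k}" if "k \<in> nbrs v I" "k \<noteq> l" "k \<noteq> m" for k
      proof -
        have "\<exists>s\<in>{p, q, r}. nbrs s I = {k}"
          using single[OF that(1)] unfolding r(1) by blast
        then show ?thesis
          using p q that by auto
      qed
      have "nbrs v I = {l, m} \<or> (\<exists>k. k \<noteq> l \<and> k \<noteq> m \<and> nbrs r I = {k} \<and> nbrs v I = {l, m, k})"
      proof (cases "nbrs v I = {l, m}")
        case False
        then obtain k where k: "k \<in> nbrs v I" "k \<noteq> l" "k \<noteq> m"
          using l m by blast
        have "nbrs v I = {l, m, k}"
          using third third[OF k] l m k by blast
        then show ?thesis
          using third[OF k] k by blast
      qed simp
      then have "real_rooted (insert p (insert q (insert r (insert v I))))"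
        using pendant[OF r(1) \<open>p \<noteq> q\<close> r(2,3), of l m] p q m by blast
      moreover have "insert p (insert q (insert r (insert v I))) = {p, q, r} \<union> insert v I"
        by auto
      moreover have "?V = {a, b, c} \<union> insert v I"
        by auto
      ultimately show ?thesis
        using r(1) by simp
    qed
  qed
qed

text \<open>If neither end of an edge st covers all edges, an edge avoiding \<open>s\<close> must
  contain \<open>t\<close>, say tu, and likewise there is an edge sw. If u = w this is a triangle;
  otherwise tu and sw are disjoint.\<close>

lemma vertex_cover_singleton:
  assumes no_matching: "\<And>s t u w. s \<in> R \<Longrightarrow> t \<in> R \<Longrightarrow> u \<in> R \<Longrightarrow> w \<in> R \<Longrightarrow>
      adj s t \<Longrightarrow> adj u w \<Longrightarrow> s \<noteq> u \<Longrightarrow> s \<noteq> w \<Longrightarrow> t \<noteq> u \<Longrightarrow> t \<noteq> w \<Longrightarrow> False"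
    and no_triangle: "\<And>s t u. s \<in> R \<Longrightarrow> t \<in> R \<Longrightarrow> u \<in> R \<Longrightarrow> adj s t \<Longrightarrow> adj s u \<Longrightarrow> adj t u \<Longrightarrow> False"
    and "\<not> coclique R"
  shows "\<exists>v\<in>R. coclique (R - {v})"
proof (rule ccontr)
  assume none: "\<not> (\<exists>v\<in>R. coclique (R - {v}))"
  obtain s t where st: "s \<in> R" "t \<in> R" "adj s t"
    using \<open>\<not> coclique R\<close> by (auto simp: coclique_def)
  obtain u where u: "u \<in> R" "u \<noteq> s" "adj t u"
  proof -
    obtain u w where uw: "u \<in> R - {s}" "w \<in> R - {s}" "adj u w"
      using none st(1) unfolding coclique_def by blast
    then have "u = t \<or> w = t"
      using no_matching[of s t u w] st by auto
    then show thesis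
      using that uw adj_sym by auto
  qed
  obtain w where w: "w \<in> R" "w \<noteq> t" "adj s w"
  proof -
    obtain u w where uw: "u \<in> R - {t}" "w \<in> R - {t}" "adj u w"
      using none st(2) unfolding coclique_def by blast
    then have "u = s \<or> w = s"
      using no_matching[of s t u w] st by auto
    then show thesis
      using that uw adj_sym by auto
  qed
  show False
  proof (cases "u = w")
    case True
    then show ?thesis
      using no_triangle[of s t u] st u w by auto
  next
    case False
    then show ?thesis
      using no_matching[of t u s w] st u w adj_sym adj_irrefl by metis
  qed
qed

text \<open>A map \<open>f\<close> whose fibres are cliques describes a clique partition with \<open>card (f ` V)\<close>
  blocks, or a proper colouring of the complementary graph.\<close>

lemma real_rooted_few_blocks:
  assumes fin: "finite V"
    and few: "\<And>f :: 'a \<Rightarrow> 'a. (\<And>u w. u \<in> V \<Longrightarrow> w \<in> V \<Longrightarrow> f u = f w \<Longrightarrow> u = w \<or> adj u w) \<Longrightarrow>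
      card V \<le> card (f ` V) + 3"
  shows "real_rooted V"
proof (cases "\<forall>v\<in>V. coclique (nbrs v V)")
  case True
  then show ?thesis
    using fin by (intro real_rooted_triangle_free) auto
next
  case False
  then obtain a b c where V: "a \<in> V" "b \<in> V" "c \<in> V" and tri: "adj a b" "adj a c" "adj b c"
    by (auto simp: coclique_def nbrs_def)
  have dist: "a \<noteq> b" "a \<noteq> c" "b \<noteq> c"
    using tri adj_irrefl by auto
  \<comment> \<open>A map that avoids four vertices of \<open>V\<close> has at most
    \<open>card V - 4\<close> values, one fewer than \<open>few\<close> allows.\<close>
  have no_four: False
    if D: "D \<subseteq> V" "card D = 4" "f ` V \<subseteq> V - D"
      and f: "\<And>u w. u \<in> V \<Longrightarrow> w \<in> V \<Longrightarrow> f u = f w \<Longrightarrow> u = w \<or> adj u w" for D and f :: "'a \<Rightarrow> 'a"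
  proof -
    have "card (f ` V) \<le> card (V - D)"
      using D(3) fin by (intro card_mono) auto
    moreover have "card D \<le> card V"
      using fin D(1) by (rule card_mono)
    moreover have "card (V - D) = card V - card D"
      using D(1) fin by (intro card_Diff_subset) (auto intro: finite_subset)
    moreover have "card V \<le> card (f ` V) + 3"
      by (rule few) (rule f)
    ultimately show False
      using D(2) by simp
  qed
  define R where "R = V - {a, b, c}"
  have R: "a \<notin> R" "b \<notin> R" "c \<notin> R" "finite R" "V = insert a (insert b (insert c R))"
    using V fin by (auto simp: R_def)
  have no_matching: False
    if "s \<in> R" "t \<in> R" "u \<in> R" "w \<in> R" "adj s t" "adj u w" "s \<noteq> u" "s \<noteq> w" "t \<noteq> u" "t \<noteq> w" for s t u w
  proof (rule no_four)
    \<comment> \<open>Contracting the triangle saves two blocks, and each of the two disjoint edges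
      saves one.\<close>
    let ?f = "id(b := a, c := a, t := s, w := u)"
    have d: "s \<noteq> t" "u \<noteq> w" "s \<noteq> u" "s \<noteq> w" "t \<noteq> u" "t \<noteq> w"
      using that adj_irrefl by auto
    have n: "a \<noteq> s" "a \<noteq> t" "a \<noteq> u" "a \<noteq> w" "b \<noteq> s" "b \<noteq> t" "b \<noteq> u" "b \<noteq> w" "c \<noteq> s" "c \<noteq> t" "c \<noteq> u" "c \<noteq> w"
      using that R(1-3) by auto
    show "{b, c, t, w} \<subseteq> V" "card {b, c, t, w} = 4"
      using that V n dist R(5) by auto
    show "?f ` V \<subseteq> V - {b, c, t, w}"
      using that V n d dist R(5) by auto
    show "x = y \<or> adj x y" if "x \<in> V" "y \<in> V" "?f x = ?f y" for x y
      using that(3) n d dist tri \<open>adj s t\<close> \<open>adj u w\<close> adj_sym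
      by (simp add: fun_upd_def split: if_splits)
  qed
  have no_triangle: False
    if "s \<in> R" "t \<in> R" "u \<in> R" "adj s t" "adj s u" "adj t u" for s t u
  proof (rule no_four)
    \<comment> \<open>Two disjoint triangles save two blocks each.\<close>
    let ?f = "id(b := a, c := a, t := s, u := s)"
    have d: "s \<noteq> t" "s \<noteq> u" "t \<noteq> u"
      using that adj_irrefl by auto
    have n: "a \<noteq> s" "a \<noteq> t" "a \<noteq> u" "b \<noteq> s" "b \<noteq> t" "b \<noteq> u" "c \<noteq> s" "c \<noteq> t" "c \<noteq> u"
      using that R(1-3) by auto
    show "{b, c, t, u} \<subseteq> V" "card {b, c, t, u} = 4"
      using that V n d dist R(5) by auto
    show "?f ` V \<subseteq> V - {b, c, t, u}"
      using that V n d dist R(5) by auto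
    show "x = y \<or> adj x y" if "x \<in> V" "y \<in> V" "?f x = ?f y" for x y
      using that(3) n d dist tri \<open>adj s t\<close> \<open>adj s u\<close> \<open>adj t u\<close> adj_sym
      by (simp add: fun_upd_def split: if_splits)
  qed
  show ?thesis
  proof (cases "coclique R")
    case True
    have "clique {a, b, c}"
      using tri adj_sym by (auto simp: clique_def)
    then have "real_rooted ({a, b, c} \<union> R)"
      using True R by (intro real_rooted_clique_Un_coclique) auto
    then show ?thesis
      using R(5) by simp
  next
    case False
    then obtain v where v: "v \<in> R" "coclique (R - {v})"
      using vertex_cover_singleton[of R] no_matching no_triangle by blast
    define I where "I = R - {v}"
    have I: "finite I" "coclique I" and notin: "a \<notin> I" "b \<notin> I" "c \<notin> I" "v \<notin> I"
      and VI: "V = insert a (insert b (insert c (insert v I)))"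
      using v R by (auto simp: I_def)
    have dv: "v \<noteq> a" "v \<noteq> b" "v \<noteq> c"
      using v(1) R(1-3) by auto
    consider "adj v a" | "adj v b" | "adj v c" | "\<not> adj v a" "\<not> adj v b" "\<not> adj v c"
      by blast
    then show ?thesis
    proof cases
      case 1
      then have "real_rooted (insert b (insert c (insert a (insert v I))))"
        using I notin dist dv tri adj_sym by (intro real_rooted_triangle_adjacent_vertex) auto
      then show ?thesis by (simp add: VI insert_commute)
    next
      case 2
      then have "real_rooted (insert a (insert c (insert b (insert v I))))"
        using I notin dist dv tri adj_sym by (intro real_rooted_triangle_adjacent_vertex) auto
      then show ?thesis by (simp add: VI insert_commute)
    next
      case 3
      then show ?thesis
        unfolding VI using I notin dist dv tri by (intro real_rooted_triangle_adjacent_vertex) auto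
    next
      case 4
      have "nbrs a I \<subseteq> {l} \<or> nbrs b I \<subseteq> {l} \<or> nbrs c I \<subseteq> {l}" if l: "l \<in> nbrs v I" for l
      proof (rule ccontr)
        assume "\<not> ?thesis"
        then obtain x y z where xyz: "x \<in> I" "adj a x" "x \<noteq> l" "y \<in> I" "adj b y" "y \<noteq> l"
            "z \<in> I" "adj c z" "z \<noteq> l"
          by (auto simp: nbrs_def)
        have lv: "l \<in> I" "adj v l"
          using l by (auto simp: nbrs_def)
        \<comment> \<open>Coincidences among \<open>x\<close>, \<open>y\<close>, \<open>z\<close>
          are harmless, since \<open>a\<close>, \<open>b\<close>, \<open>c\<close> are mutually
          adjacent. None of them equals \<open>l\<close>, so \<open>v\<close> is never merged with a
          triangle vertex.\<close>
        let ?f = "id(a := x, b := y, c := z, v := l)"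
        show False
        proof (rule no_four)
          show "{a, b, c, v} \<subseteq> V" "card {a, b, c, v} = 4"
            using dist dv by (auto simp: VI)
          show "?f ` V \<subseteq> V - {a, b, c, v}"
            using notin xyz lv by (auto simp: VI)
          show "p = q \<or> adj p q" if "p \<in> V" "q \<in> V" "?f p = ?f q" for p q
            using that(3) notin dist dv tri xyz lv adj_sym
            by (simp add: fun_upd_def split: if_splits)
        qed
      qed
      then show ?thesis
        unfolding VI using I notin dist dv tri 4 by (intro real_rooted_triangle_and_vertex) auto
    qed
  qed
qed

end

section \<open>The sigma-polynomial\<close>

text \<open>The colours may have any type and are renumbered by a bijection \<open>h\<close>; both
  blocks and representative vertices will serve as colours.\<close>

lemma chromatic_number_le_card_image:
  assumes fin: "finite (pverts G)" and arcs: "parcs G \<subseteq> pverts G \<times> pverts G"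
    and f: "\<And>u v. (u, v) \<in> parcs G \<Longrightarrow> f u \<noteq> f v"
  shows "chromatic_number G \<le> card (f ` pverts G)"
proof -
  obtain h where h: "bij_betw h (f ` pverts G) {0..<card (f ` pverts G)}"
    using ex_bij_betw_finite_nat[of "f ` pverts G"] fin by auto
  have "h (f u) \<noteq> h (f v)" if "(u, v) \<in> parcs G" for u v
    using f[OF that] that arcs bij_betw_imp_inj_on[OF h] by (auto dest: inj_onD)
  then have "proper_colouring G (card (f ` pverts G)) (h \<circ> f)"
    using bij_betw_imp_surj_on[OF h] by (fastforce simp: proper_colouring_def)
  then show ?thesis
    unfolding chromatic_number_def by (intro Least_le) blast
qed

text \<open>Colouring each vertex by its block is proper and uses every block. Hence the summation
  range of \<open>sigma_poly\<close> misses no partition.\<close>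

lemma independent_partitions_card_bounds:
  assumes G: "pair_graph G" and P: "P \<in> independent_partitions G i"
  shows "chromatic_number G \<le> i" "i \<le> card (pverts G)"
proof -
  interpret pair_graph G by fact
  have part: "partition_on (pverts G) P" and i: "card P = i"
    and indep: "\<And>S. S \<in> P \<Longrightarrow> independent_set G S"
    using P by (auto simp: independent_partitions_def)
  define block where "block u = (THE B. B \<in> P \<and> u \<in> B)" for u
  have block_eq: "block u = B" if "B \<in> P" "u \<in> B" for u B
    unfolding block_def
    using that partition_onD2[OF part] by (intro the_equality) (auto simp: disjoint_def)
  have block: "block u \<in> P \<and> u \<in> block u" if "u \<in> pverts G" for u
    using that partition_onD1[OF part] block_eq by fastforce
  have image: "block ` pverts G = P"
  proof
    show "P \<subseteq> block ` pverts G"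
    proof
      fix B assume B: "B \<in> P"
      then obtain u where "u \<in> B"
        using partition_onD3[OF part] by (cases "B = {}") auto
      then show "B \<in> block ` pverts G"
        using block_eq[OF B] B partition_onD1[OF part] by blast
    qed
  qed (use block in auto)
  have "block u \<noteq> block v" if "(u, v) \<in> parcs G" for u v
    using block[of u] block[of v] indep[of "block u"] that in_arcsD1[OF that] in_arcsD2[OF that]
    by (auto simp: independent_set_def)
  moreover have "parcs G \<subseteq> pverts G \<times> pverts G"
    using in_arcsD1 in_arcsD2 by auto
  ultimately show "chromatic_number G \<le> i"
    using chromatic_number_le_card_image[of G block] pair_finite_verts by (simp add: image i)
  show "i \<le> card (pverts G)"
    using card_image_le[OF pair_finite_verts, of block] by (simp add: image i)
qed

theorem theorem3p6:
  fixes G :: "'a pair_pre_digraph" and n :: nat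
  assumes "pair_graph G"
    and "card (pverts G) = n"
    and "int (chromatic_number G) = int n - 3"
  shows "\<forall>z::complex. poly (map_poly of_int (sigma_poly G)) z = 0 \<longrightarrow> z \<in> \<real>"
proof -
  interpret pair_graph G by fact
  let ?V = "pverts G"
  \<comment> \<open>This is the complementary graph, extended to the whole type; only its
    restriction to \<open>?V\<close> matters for clique partitions.\<close>
  define adj where "adj u v \<longleftrightarrow> u \<noteq> v \<and> (u, v) \<notin> parcs G" for u v
  interpret adjacency adj
  proof
    show "adj v u" if "adj u v" for u v
      using that arcs_symmetric[of v u] by (auto simp: adj_def)
  qed (simp add: adj_def)
  have loopfree: "u \<noteq> v" if "(u, v) \<in> parcs G" for u v
    using pair_no_loops[OF that] by simp
  have parts: "independent_partitions G i = {P \<in> clique_partitions ?V. card P = i}" for i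
  proof -
    have "independent_set G S \<longleftrightarrow> clique S" if "S \<subseteq> ?V" for S
      using that by (auto simp: independent_set_def clique_def adj_def dest: loopfree)
    moreover have "S \<subseteq> ?V" if "partition_on ?V P" "S \<in> P" for S P
      using partition_onD1[OF that(1)] that(2) by blast
    ultimately show ?thesis
      unfolding independent_partitions_def clique_partitions_def by blast
  qed
  have "map_poly of_int (sigma_poly G) = cpoly ?V"
  proof (rule poly_eqI)
    fix i
    have "coeff (cpoly ?V) i = (\<Sum>P\<in>clique_partitions ?V. if card P = i then 1 else 0)"
      by (simp add: cpoly_def coeff_sum)
    also have "\<dots> = of_nat (card (independent_partitions G i))"
      using finite_clique_partitions[OF pair_finite_verts]
      by (simp add: parts sum.inter_filter[symmetric])
    finally have c: "coeff (cpoly ?V) i = of_nat (card (independent_partitions G i))" .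
    have "coeff (sigma_poly G) i = int (card (independent_partitions G i))"
    \<comment> \<open>Without partitions into \<open>i\<close> blocks the coefficient is 0 inside
      and outside the summation range; otherwise \<open>i\<close> lies in the range.\<close>
    proof (cases "independent_partitions G i = {}")
      case True
      then show ?thesis
        by (auto simp: sigma_poly_def coeff_sum intro!: sum.neutral)
    next
      case False
      then have "i \<in> {chromatic_number G..card ?V}"
        using independent_partitions_card_bounds[OF \<open>pair_graph G\<close>, of _ i] by auto
      then show ?thesis
        by (simp add: sigma_poly_def coeff_sum)
    qed
    then show "coeff (map_poly of_int (sigma_poly G)) i = coeff (cpoly ?V) i"
      by (simp add: coeff_map_poly c)
  qed
  moreover have "real_rooted ?V"
  proof (rule real_rooted_few_blocks[OF pair_finite_verts])
    fix f :: "'a \<Rightarrow> 'a"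
    assume f: "\<And>u w. u \<in> ?V \<Longrightarrow> w \<in> ?V \<Longrightarrow> f u = f w \<Longrightarrow> u = w \<or> adj u w"
    have "f u \<noteq> f v" if "(u, v) \<in> parcs G" for u v
      using f[of u v] that loopfree[OF that] in_arcsD1[OF that] in_arcsD2[OF that] by (auto simp: adj_def)
    then have "chromatic_number G \<le> card (f ` ?V)"
      using in_arcsD1 in_arcsD2 by (intro chromatic_number_le_card_image pair_finite_verts) auto
    then show "card ?V \<le> card (f ` ?V) + 3"
      using assms(2,3) by simp
  qed
  ultimately show ?thesis
    by (simp add: real_rooted_def)
qed

end
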